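(* Among the partitions of $n$ into distinct parts such that each odd part is less than twice the smallest part, let $d_o(n)$ be the number of such partitions with an odd number of parts and let $d_e(n)$ be the number of such partitions with an even number of parts. Then, for $j\ge 0$, $$d_o(n)-d_e(n)=\begin{cases}(-1)^j, & \text{if } n=3j^2+2j \text{ or } n=3j^2+4j+1,\\ 0, & \text{otherwise.}\end{cases}$$
   Context: Here $j$ ranges over the nonnegative integers, and "otherwise" means that $n$ is of neither of the two forms for any integer $j\ge 0$. A partition of $n$ into distinct parts is a representation of $n$ as a sum of distinct positive integers (the parts), without regard to order. There is no restriction on even parts.
   Formalization: The parts are taken to be distinct nonnegative integers (0 may be a part, and at least one part is required) instead of positive integers, because with positive parts the claim fails, e.g. for n = 2 (only the partition {2}, difference 1 rather than 0). *)

theory Defs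
  imports Complex_Main
begin

text \<open>
  A partition into distinct parts is represented by the finite set of its parts.
  The number 0 is admitted as a part (at most once, as the parts are distinct), and there has to be
  at least one part, so that a smallest part exists. With positive parts only, the theorem
  about these partitions would be false: for \<open>n = 2\<close> the only partition would be \<open>{2}\<close>, giving
  the difference 1 instead of 0. With 0 admitted, \<open>{2}\<close> is cancelled by \<open>{0, 2}\<close>.
  If 0 is a part, then no part can be odd; hence for odd \<open>n\<close> all parts are positive anyway.
\<close>

definition distinct_partitions :: "nat \<Rightarrow> nat set set" where
  "distinct_partitions n = {P. finite P \<and> P \<noteq> {} \<and> \<Sum>P = n}"

definition odd_bounded_partitions :: "nat \<Rightarrow> nat set set" where
  "odd_bounded_partitions n =
     {P \<in> distinct_partitions n. \<forall>p\<in>P. odd p \<longrightarrow> p < 2 * Min P}"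

definition d_o :: "nat \<Rightarrow> nat" where
  "d_o n = card {P \<in> odd_bounded_partitions n. odd (card P)}"

definition d_e :: "nat \<Rightarrow> nat" where
  "d_e n = card {P \<in> odd_bounded_partitions n. even (card P)}"

lemma finite_distinct_partitions: "finite (distinct_partitions n)"
proof (rule finite_subset)
  show "distinct_partitions n \<subseteq> Pow {..n}"
    unfolding distinct_partitions_def using member_le_sum[of _ _ "\<lambda>x::nat. x"] by fastforce
qed simp

lemma finite_odd_bounded_partitions: "finite (odd_bounded_partitions n)"
  unfolding odd_bounded_partitions_def by (simp add: finite_distinct_partitions)

end

theory Submission
  imports Defs "HOL-Computational_Algebra.Polynomial"
begin

text \<open>
  Write \<open>(a; p)\<^sub>n\<close> for the product of the \<open>1 - a p\<^sup>i\<close> over \<open>i < n\<close>. Sorting the partitions by their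
  smallest part \<open>n\<close>, the generating function of \<open>d_o - d_e\<close> is the case \<open>r = 0\<close> of
  \[ S_r = \sum_n q^{(r+1)n} (q^{n+1}; q)_n (q^{2n+2}; q^2)_\infty . \]
  Both \<open>S_r\<close> and \<open>B_r = \sum_m q^m (q; q)_{2m+r} / (q^2; q^2)_m\<close> satisfy
  \[ (1 - q^{r+1}) D_r = D_{r+1} - q^{r+2} D_{r+2} , \]
  and both tend to \<open>(q^2; q^2)_\infty\<close> as \<open>r\<close> grows, so they agree. In particular the generating function
  equals \<open>B_0 = \sum_m q^m (q; q^2)_m\<close>. Two functional equations of Rogers and Fine for
  \<open>F(a, t) = \sum_m (a; q^2)_m t^m\<close> combine to
  \[ F(a, a) = 1 + a - a^3 q^2 F(a q^2, a q^2) , \]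
  and iterating this from \<open>a = q\<close> produces the false theta series
  \<open>\sum_j (-1)^j q^{3j^2+2j} (1 + q^{2j+1})\<close>.

  All sums and products are truncated at \<open>L\<close>, and all identities hold modulo \<open>q^L\<close> in an arbitrary
  commutative ring; convergence never enters.
\<close>

section \<open>Congruences modulo powers of \<open>q\<close>\<close>

text \<open>Induction on the exponent: if \<open>q ^ k\<close> divides \<open>f\<close>, then
  \<open>q ^ Suc k\<close> divides \<open>a * f\<close> and hence
  \<open>f = (1 - a) * f + a * f\<close>. This replaces inverting \<open>1 - a\<close> by a
  geometric series.\<close>

lemma power_dvd_cancel_one_minus:
  fixes q a f :: "'a::comm_ring_1"
  assumes "q dvd a" and "q ^ N dvd (1 - a) * f"
  shows "q ^ N dvd f"
proof -
  have "q ^ k dvd f" if "k \<le> N" for k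
    using that
  proof (induction k)
    case (Suc k)
    then have "q * q ^ k dvd a * f"
      using assms(1) by (intro mult_dvd_mono) auto
    moreover have "q ^ Suc k dvd (1 - a) * f"
      by (rule dvd_trans[OF le_imp_power_dvd[OF Suc.prems] assms(2)])
    ultimately have "q ^ Suc k dvd (1 - a) * f + a * f"
      by (intro dvd_add) auto
    then show ?case
      by (simp add: algebra_simps)
  qed simp
  then show ?thesis
    by blast
qed

lemma power_dvd_cancel_prod_one_minus:
  fixes q f :: "'a::comm_ring_1"
  assumes "finite A" and "\<And>i. i \<in> A \<Longrightarrow> q dvd a i" and "q ^ N dvd (\<Prod>i\<in>A. 1 - a i) * f"
  shows "q ^ N dvd f"
  using assms
proof (induction A rule: finite_induct)
  case (insert x A)
  have "q ^ N dvd (1 - a x) * ((\<Prod>i\<in>A. 1 - a i) * f)"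
    using insert.prems insert.hyps by (simp add: mult.assoc)
  then have "q ^ N dvd (\<Prod>i\<in>A. 1 - a i) * f"
    by (rule power_dvd_cancel_one_minus[rotated]) (simp add: insert.prems)
  then show ?case
    using insert.IH insert.prems by simp
qed simp

text \<open>Since \<open>1 - q ^ (r + 1)\<close> can be cancelled, \<open>D (r + 1)\<close> and
  \<open>D (r + 2)\<close> determine \<open>D r\<close>. Applied to the difference of two solutions,
  this is a uniqueness statement.\<close>

lemma power_dvd_backward_recurrence:
  fixes q :: "'a::comm_ring_1" and D :: "nat \<Rightarrow> 'a"
  assumes rec: "\<And>r. q ^ N dvd (1 - q ^ (r + 1)) * D r - D (r + 1) + q ^ (r + 2) * D (r + 2)"
    and large: "\<And>r. r \<ge> R \<Longrightarrow> q ^ N dvd D r"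
  shows "q ^ N dvd D r"
proof (induction "R - r" arbitrary: r rule: less_induct)
  case less
  show ?case
  proof (cases "r \<ge> R")
    case False
    then have "q ^ N dvd D (r + 1)" "q ^ N dvd D (r + 2)"
      using less[of "r + 1"] less[of "r + 2"] by simp_all
    then have "q ^ N dvd ((1 - q ^ (r + 1)) * D r - D (r + 1) + q ^ (r + 2) * D (r + 2))
                 + (D (r + 1) - q ^ (r + 2) * D (r + 2))"
      by (intro dvd_add rec dvd_diff dvd_mult)
    then have "q ^ N dvd (1 - q ^ (r + 1)) * D r"
      by (simp add: algebra_simps)
    then show ?thesis
      by (rule power_dvd_cancel_one_minus[rotated]) simp
  qed (use large in auto)
qed

section \<open>The sums \<open>S_r\<close> and \<open>B_r\<close> and their common
  recurrence\<close>

text \<open>The exponents are \<open>n + 1, ..., 2 * n\<close> and then the even numbers from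
  \<open>2 * n + 2\<close> to \<open>2 * L\<close>: the parts allowed besides a smallest part
  \<open>n\<close>.\<close>

definition min_part_prod :: "'a::comm_ring_1 \<Rightarrow> nat \<Rightarrow> nat \<Rightarrow> 'a" where
  "min_part_prod q L n = (\<Prod>i<n. 1 - q ^ (n + 1 + i)) * (\<Prod>i\<in>{n<..L}. 1 - q ^ (2 * i))"

definition min_part_sum :: "'a::comm_ring_1 \<Rightarrow> nat \<Rightarrow> nat \<Rightarrow> 'a" where
  "min_part_sum q L r = (\<Sum>n\<le>L. q ^ ((r + 1) * n) * min_part_prod q L n)"

text \<open>This is the quotient \<open>(q; q)_{2m+r} / (q^2; q^2)_m\<close>, written without division.\<close>

definition odd_block_prod :: "'a::comm_ring_1 \<Rightarrow> nat \<Rightarrow> nat \<Rightarrow> 'a" where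
  "odd_block_prod q r m = (\<Prod>i<m. 1 - q ^ (2 * i + 1)) * (\<Prod>i<r. 1 - q ^ (2 * m + 1 + i))"

text \<open>\<open>B_r\<close> is the case \<open>s = 1\<close>; general \<open>s\<close> allows the
  shifts by 2 that evaluate the sum for large \<open>r\<close>.\<close>

definition odd_block_sum :: "'a::comm_ring_1 \<Rightarrow> nat \<Rightarrow> nat \<Rightarrow> nat \<Rightarrow> 'a" where
  "odd_block_sum q L r s = (\<Sum>m\<le>L. q ^ (s * m) * odd_block_prod q r m)"

text \<open>From \<open>n\<close> to \<open>n + 1\<close>, the exponent \<open>n + 1\<close> leaves
  the first product, \<open>2 * n + 1\<close> enters it, and \<open>2 * n + 2\<close> moves over
  from the second.\<close>

lemma min_part_prod_Suc:
  assumes "n < L"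
  shows "(1 - q ^ (n + 1)) * min_part_prod q L (Suc n)
      = (1 - q ^ (2 * n + 1)) * min_part_prod q L n"
proof -
  have "(1 - q ^ (n + 1)) * (\<Prod>i<Suc n. 1 - q ^ (Suc n + 1 + i))
      = (\<Prod>i<Suc (Suc n). 1 - q ^ (n + 1 + i))"
    by (subst (2) prod.lessThan_Suc_shift) (simp del: prod.lessThan_Suc)
  also have "\<dots> = (\<Prod>i<n. 1 - q ^ (n + 1 + i)) * (1 - q ^ (2 * n + 1)) * (1 - q ^ (2 * n + 2))"
    by (simp add: mult_2)
  finally have 1: "(1 - q ^ (n + 1)) * (\<Prod>i<Suc n. 1 - q ^ (Suc n + 1 + i)) =
    (\<Prod>i<n. 1 - q ^ (n + 1 + i)) * (1 - q ^ (2 * n + 1)) * (1 - q ^ (2 * n + 2))" .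
  have "{n<..L} = insert (Suc n) {Suc n<..L}"
    using assms by auto
  then have 2: "(\<Prod>i\<in>{n<..L}. 1 - q ^ (2 * i))
      = (1 - q ^ (2 * n + 2)) * (\<Prod>i\<in>{Suc n<..L}. 1 - q ^ (2 * i))"
    by simp
  show ?thesis
    unfolding min_part_prod_def 2 mult.assoc[symmetric] 1 by (simp only: mult_ac)
qed

text \<open>In \<open>S_r - S_{r+1}\<close> each term gains a factor \<open>1 - q ^ n\<close>, so
  the term \<open>n = 0\<close> drops out. Shifting the index and applying
  \<open>min_part_prod_Suc\<close> gives sums of the same type; only the boundary term
  \<open>?g L\<close> is left over.\<close>

lemma min_part_sum_recurrence:
  "q ^ L dvd (1 - q ^ (r + 1)) * min_part_sum q L r - min_part_sum q L (r + 1)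
      + q ^ (r + 2) * min_part_sum q L (r + 2)"
proof (cases L)
  case (Suc K)
  let ?f = "\<lambda>n. q ^ ((r + 1) * n) * ((1 - q ^ n) * min_part_prod q L n)"
  let ?g = "\<lambda>n. q ^ ((r + 1) * Suc n) * ((1 - q ^ (2 * n + 1)) * min_part_prod q L n)"
  have "min_part_sum q L r - min_part_sum q L (r + 1) = (\<Sum>n\<le>L. ?f n)"
    unfolding min_part_sum_def sum_subtractf[symmetric]
    by (intro sum.cong) (auto simp: algebra_simps power_add)
  also have "\<dots> = (\<Sum>n\<le>K. ?f (Suc n))"
    unfolding Suc by (subst sum.atMost_Suc_shift) simp
  also have "\<dots> = (\<Sum>n\<le>K. ?g n)"
    using Suc min_part_prod_Suc[of _ L q] by (intro sum.cong) (auto simp del: mult_Suc_right)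
  also have "\<dots> = (\<Sum>n\<le>L. ?g n) - ?g L"
    using Suc by (simp only: sum.atMost_Suc add_diff_cancel_right')
  also have "(\<Sum>n\<le>L. ?g n)
      = q ^ (r + 1) * min_part_sum q L r - q ^ (r + 2) * min_part_sum q L (r + 2)"
    unfolding min_part_sum_def sum_distrib_left sum_subtractf[symmetric]
    by (intro sum.cong) (auto simp: algebra_simps power_add mult_2_right)
  finally have "(1 - q ^ (r + 1)) * min_part_sum q L r - min_part_sum q L (r + 1)
      + q ^ (r + 2) * min_part_sum q L (r + 2) = - ?g L"
    by (simp add: algebra_simps)
  moreover have "q ^ L dvd ?g L"
    by (intro dvd_mult2 le_imp_power_dvd) simp
  ultimately show ?thesis
    by simp
qed simp

lemma odd_block_prod_Suc: "odd_block_prod q (Suc r) m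
    = (1 - q ^ (2 * m + 1 + r)) * odd_block_prod q r m"
  by (simp add: odd_block_prod_def mult_ac)

lemma odd_block_prod_Suc_Suc: "odd_block_prod q (Suc (Suc r)) m
    = (1 - q ^ (2 * m + 2)) * odd_block_prod q r (Suc m)"
  unfolding odd_block_prod_def
  by (simp add: prod.lessThan_Suc_shift[of _ "Suc r"] prod.lessThan_Suc_shift[of _ r] mult_ac
        del: prod.lessThan_Suc)
    (simp add: mult_ac)

text \<open>The same index shift, with the factor \<open>1 - q ^ (2 * m)\<close> absorbed by raising
  \<open>r\<close> by 2. Positivity of \<open>s\<close> makes the boundary term divisible by
  \<open>q ^ L\<close>.\<close>

lemma odd_block_sum_shift:
  assumes "s > 0"
  shows "q ^ L dvd odd_block_sum q L r s - odd_block_sum q L r (s + 2)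
      - q ^ s * odd_block_sum q L (r + 2) s"
proof (cases L)
  case (Suc K)
  let ?f = "\<lambda>m. q ^ (s * m) * ((1 - q ^ (2 * m)) * odd_block_prod q r m)"
  let ?g = "\<lambda>m. q ^ (s * Suc m) * odd_block_prod q (r + 2) m"
  have "odd_block_sum q L r s - odd_block_sum q L r (s + 2) = (\<Sum>m\<le>L. ?f m)"
    unfolding odd_block_sum_def sum_subtractf[symmetric]
    by (intro sum.cong) (auto simp: algebra_simps power_add mult_2_right)
  also have "\<dots> = (\<Sum>m\<le>K. ?f (Suc m))"
    unfolding Suc by (subst sum.atMost_Suc_shift) simp
  also have "\<dots> = (\<Sum>m\<le>K. ?g m)"
    by (intro sum.cong) (auto simp: odd_block_prod_Suc_Suc)
  also have "\<dots> = (\<Sum>m\<le>L. ?g m) - ?g L"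
    using Suc by (simp only: sum.atMost_Suc add_diff_cancel_right')
  also have "(\<Sum>m\<le>L. ?g m) = q ^ s * odd_block_sum q L (r + 2) s"
    unfolding odd_block_sum_def sum_distrib_left
    by (intro sum.cong) (auto simp: algebra_simps power_add)
  finally have "odd_block_sum q L r s - odd_block_sum q L r (s + 2)
      - q ^ s * odd_block_sum q L (r + 2) s = - ?g L"
    by (simp add: algebra_simps)
  moreover have "q ^ L dvd ?g L"
    using assms by (intro dvd_mult2 le_imp_power_dvd) (cases s; simp)
  ultimately show ?thesis
    by simp
qed simp

lemma odd_block_sum_recurrence:
  "q ^ L dvd (1 - q ^ (r + 1)) * odd_block_sum q L r 1 - odd_block_sum q L (r + 1) 1
      + q ^ (r + 2) * odd_block_sum q L (r + 2) 1"
proof -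
  \<comment> \<open>Termwise, \<open>(1 - q ^ (r + 1)) - (1 - q ^ (2 * m + 1 + r)) = - q ^ (r + 1) *
    (1 - q ^ (2 * m))\<close>.\<close>
  have "(1 - q ^ (r + 1)) * odd_block_sum q L r 1 - odd_block_sum q L (r + 1) 1
      = - (q ^ (r + 1) * (odd_block_sum q L r 1 - odd_block_sum q L r (1 + 2)))"
    unfolding odd_block_sum_def sum_distrib_left sum_subtractf[symmetric] sum_negf[symmetric]
    by (intro sum.cong)
      (auto simp: algebra_simps power_add odd_block_prod_Suc mult_2 mult_2_right power3_eq_cube)
  then have "(1 - q ^ (r + 1)) * odd_block_sum q L r 1 - odd_block_sum q L (r + 1) 1
      + q ^ (r + 2) * odd_block_sum q L (r + 2) 1
      = - (q ^ (r + 1) * (odd_block_sum q L r 1 - odd_block_sum q L r (1 + 2)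
      - q ^ 1 * odd_block_sum q L (r + 2) 1))"
    by (simp add: algebra_simps)
  then show ?thesis
    using odd_block_sum_shift[of 1 q L r] by simp
qed

section \<open>Evaluation for large \<open>r\<close> and equality of the two sums\<close>

lemma odd_block_sum_Suc_cong:
  assumes "r \<ge> L"
  shows "q ^ L dvd odd_block_sum q L (Suc r) s - odd_block_sum q L r s"
proof -
  have "odd_block_sum q L (Suc r) s - odd_block_sum q L r s
      = - (\<Sum>m\<le>L. q ^ (s * m) * (q ^ (2 * m + 1 + r) * odd_block_prod q r m))"
    unfolding odd_block_sum_def sum_subtractf[symmetric] sum_negf[symmetric]
    by (intro sum.cong) (auto simp: algebra_simps odd_block_prod_Suc)
  moreover have "q ^ L dvd (\<Sum>m\<le>L. q ^ (s * m) * (q ^ (2 * m + 1 + r) * odd_block_prod q r m))"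
    using assms by (intro dvd_sum dvd_mult dvd_mult2 le_imp_power_dvd) auto
  ultimately show ?thesis
    by simp
qed

text \<open>For \<open>r \<ge> L\<close> raising \<open>r\<close> changes nothing modulo
  \<open>q ^ L\<close>, so \<open>odd_block_sum_shift\<close> becomes a recurrence in
  \<open>s\<close> alone.\<close>

lemma odd_block_sum_shift_large:
  assumes "r \<ge> L" "s > 0"
  shows "q ^ L dvd (1 - q ^ s) * odd_block_sum q L r s - odd_block_sum q L r (s + 2)"
proof -
  have "(1 - q ^ s) * odd_block_sum q L r s - odd_block_sum q L r (s + 2)
      = (odd_block_sum q L r s - odd_block_sum q L r (s + 2) - q ^ s * odd_block_sum q L (r + 2) s)
        + q ^ s * ((odd_block_sum q L (Suc (Suc r)) s - odd_block_sum q L (Suc r) s)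
        + (odd_block_sum q L (Suc r) s - odd_block_sum q L r s))"
    by (simp add: algebra_simps)
  also have "q ^ L dvd \<dots>"
    using assms by (intro dvd_add odd_block_sum_shift dvd_mult odd_block_sum_Suc_cong) auto
  finally show ?thesis .
qed

text \<open>
  For \<open>J = L\<close> this takes the place of Euler's identity \<open>\<Sum>\<^sub>m q\<^sup>m / (q\<^sup>2; q\<^sup>2)\<^sub>m = 1 / (q; q\<^sup>2)\<^sub>\<infinity>\<close>
  in the evaluation of the sums for large \<open>r\<close>.
\<close>

lemma odd_block_sum_shift_iterated:
  assumes "r \<ge> L"
  shows "q ^ L dvd (\<Prod>i<J. 1 - q ^ (2 * i + 1)) * odd_block_sum q L r 1
      - odd_block_sum q L r (2 * J + 1)"
proof (induction J)
  case (Suc J)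
  have "(\<Prod>i<Suc J. 1 - q ^ (2 * i + 1)) * odd_block_sum q L r 1
      - odd_block_sum q L r (2 * Suc J + 1)
     = (1 - q ^ (2 * J + 1)) * ((\<Prod>i<J. 1 - q ^ (2 * i + 1)) * odd_block_sum q L r 1
       - odd_block_sum q L r (2 * J + 1))
       + ((1 - q ^ (2 * J + 1)) * odd_block_sum q L r (2 * J + 1)
       - odd_block_sum q L r (2 * J + 1 + 2))"
    by (simp add: algebra_simps)
  also have "q ^ L dvd \<dots>"
    using assms by (intro dvd_add dvd_mult Suc.IH odd_block_sum_shift_large) auto
  finally show ?case .
qed simp

lemma power_dvd_sum_diff_first:
  fixes q :: "'a::comm_ring_1"
  assumes "s \<ge> L"
  shows "q ^ L dvd (\<Sum>m\<le>M. q ^ (s * m) * f m) - f 0"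
proof -
  have "q ^ L dvd (\<Sum>m<M. q ^ (s * Suc m) * f (Suc m))"
    using assms by (intro dvd_sum dvd_mult2 le_imp_power_dvd) auto
  then show ?thesis
    by (simp add: sum.atMost_shift)
qed

lemma prod_split_parity:
  fixes f :: "nat \<Rightarrow> 'a::comm_monoid_mult"
  shows "(\<Prod>i<2 * L. f (i + 1)) = (\<Prod>i<L. f (2 * i + 1)) * (\<Prod>i\<in>{0<..L}. f (2 * i))"
proof (induction L)
  case (Suc L)
  have "{0<..Suc L} = insert (Suc L) {0<..L}"
    by auto
  then show ?case
    using Suc by (simp add: mult_ac)
qed simp

text \<open>At \<open>r = 2 * L\<close>, shifting \<open>s\<close> up to \<open>2 * L + 1\<close>
  leaves only the term \<open>m = 0\<close>, which is \<open>(q; q)_{2L}\<close>. Cancelling its odd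
  factors leaves \<open>(q^2; q^2)_L\<close>; larger \<open>r\<close> follow by stability.\<close>

lemma odd_block_sum_large:
  assumes "r \<ge> 2 * L"
  shows "q ^ L dvd odd_block_sum q L r 1 - min_part_prod q L 0"
  using assms
proof (induction r rule: dec_induct)
  case base
  let ?P = "\<Prod>i<L. 1 - q ^ (2 * i + 1)"
  have "odd_block_prod q (2 * L) 0 = ?P * min_part_prod q L 0"
    using prod_split_parity[of "\<lambda>i. 1 - q ^ i" L]
    by (simp add: odd_block_prod_def min_part_prod_def)
  then have "?P * (odd_block_sum q L (2 * L) 1 - min_part_prod q L 0)
     = (?P * odd_block_sum q L (2 * L) 1 - odd_block_sum q L (2 * L) (2 * L + 1))
     + (odd_block_sum q L (2 * L) (2 * L + 1) - odd_block_prod q (2 * L) 0)"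
    by (simp add: algebra_simps)
  also have "q ^ L dvd \<dots>"
  proof (rule dvd_add[OF odd_block_sum_shift_iterated])
    show "q ^ L dvd odd_block_sum q L (2 * L) (2 * L + 1) - odd_block_prod q (2 * L) 0"
      unfolding odd_block_sum_def by (rule power_dvd_sum_diff_first) simp
  qed simp
  finally show ?case
    by (rule power_dvd_cancel_prod_one_minus[rotated 2]) auto
next
  case (step r)
  have "q ^ L dvd (odd_block_sum q L (Suc r) 1 - odd_block_sum q L r 1)
      + (odd_block_sum q L r 1 - min_part_prod q L 0)"
    using step by (intro dvd_add odd_block_sum_Suc_cong) auto
  then show ?case
    by simp
qed

lemma min_part_sum_cong_odd_block_sum: "q ^ L dvd min_part_sum q L 0 - odd_block_sum q L 0 1"
proof (rule power_dvd_backward_recurrence[where D = "\<lambda>r. min_part_sum q L r - odd_block_sum q L r 1"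
      and R = "2 * L"])
  fix r
  have "q ^ L dvd ((1 - q ^ (r + 1)) * min_part_sum q L r - min_part_sum q L (r + 1)
      + q ^ (r + 2) * min_part_sum q L (r + 2))
    - ((1 - q ^ (r + 1)) * odd_block_sum q L r 1 - odd_block_sum q L (r + 1) 1
    + q ^ (r + 2) * odd_block_sum q L (r + 2) 1)"
    by (intro dvd_diff min_part_sum_recurrence odd_block_sum_recurrence)
  then show "q ^ L dvd (1 - q ^ (r + 1)) * (min_part_sum q L r - odd_block_sum q L r 1)
      - (min_part_sum q L (r + 1) - odd_block_sum q L (r + 1) 1)
      + q ^ (r + 2) * (min_part_sum q L (r + 2) - odd_block_sum q L (r + 2) 1)"
    by (simp add: algebra_simps)
next
  fix r assume "2 * L \<le> r"
  then have "q ^ L dvd (min_part_sum q L r - min_part_prod q L 0)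
      - (odd_block_sum q L r 1 - min_part_prod q L 0)"
    \<comment> \<open>For such \<open>r\<close> only the term \<open>n = 0\<close> of
      \<open>S_r\<close> survives.\<close>
    unfolding min_part_sum_def by (intro dvd_diff odd_block_sum_large power_dvd_sum_diff_first) auto
  then show "q ^ L dvd min_part_sum q L r - odd_block_sum q L r 1"
    by simp
qed

section \<open>Rogers-Fine sums and the false theta series\<close>

definition rogers_fine_sum :: "nat \<Rightarrow> 'a::comm_ring_1 \<Rightarrow> 'a \<Rightarrow> 'a \<Rightarrow> 'a" where
  "rogers_fine_sum M q a t = (\<Sum>m<M. (\<Prod>i<m. 1 - a * q ^ (2 * i)) * t ^ m)"

lemma rogers_fine_sum_Suc_shift: "rogers_fine_sum (Suc M) q a t
    = 1 + t * (1 - a) * rogers_fine_sum M q (a * q\<^sup>2) t"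
proof -
  have "rogers_fine_sum (Suc M) q a t = 1 + (\<Sum>m<M. (\<Prod>i<Suc m. 1 - a * q ^ (2 * i)) * t ^ Suc m)"
    unfolding rogers_fine_sum_def sum.lessThan_Suc_shift by simp
  also have "(\<Sum>m<M. (\<Prod>i<Suc m. 1 - a * q ^ (2 * i)) * t ^ Suc m)
      = t * (1 - a) * rogers_fine_sum M q (a * q\<^sup>2) t"
    unfolding rogers_fine_sum_def prod.lessThan_Suc_shift sum_distrib_left
    by (intro sum.cong) (auto simp: mult_ac power_add power2_eq_square)
  finally show ?thesis .
qed

text \<open>Multiplying the \<open>m\<close>-th term by \<open>t * (1 - a * q ^ (2 * m))\<close>
  gives the next term; summing this relation telescopes up to the first and last terms.\<close>

lemma rogers_fine_sum_arg_shift: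
  "(1 - t) * rogers_fine_sum M q a t
      = 1 - a * t * rogers_fine_sum M q a (t * q\<^sup>2) - (\<Prod>i<M. 1 - a * q ^ (2 * i)) * t ^ M"
  unfolding rogers_fine_sum_def
  by (induction M) (simp_all add: algebra_simps power_mult_distrib power_mult[symmetric])

text \<open>On the diagonal \<open>t = a\<close>, the factor \<open>1 - a\<close> from the first
  functional equation is the \<open>1 - t\<close> with which the second one starts.\<close>

lemma rogers_fine_sum_diagonal:
  "rogers_fine_sum (Suc M) q a a = 1 + a - a ^ 3 * q\<^sup>2 * rogers_fine_sum M q (a * q\<^sup>2) (a * q\<^sup>2)
     - a ^ Suc M * (\<Prod>i<M. 1 - a * q\<^sup>2 * q ^ (2 * i))"
proof -
  let ?P = "\<Prod>i<M. 1 - a * q\<^sup>2 * q ^ (2 * i)"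
  have "rogers_fine_sum (Suc M) q a a = 1 + a * ((1 - a) * rogers_fine_sum M q (a * q\<^sup>2) a)"
    by (simp add: rogers_fine_sum_Suc_shift mult.assoc)
  also have "\<dots> = 1 + a * (1 - a * q\<^sup>2 * a * rogers_fine_sum M q (a * q\<^sup>2) (a * q\<^sup>2) - ?P * a ^ M)"
    unfolding rogers_fine_sum_arg_shift ..
  also have "\<dots> = 1 + a - a ^ 3 * q\<^sup>2 * rogers_fine_sum M q (a * q\<^sup>2) (a * q\<^sup>2) - a ^ Suc M * ?P"
    by (simp add: right_diff_distrib mult_ac power3_eq_cube)
  finally show ?thesis .
qed

lemma rogers_fine_sum_odd_power:
  assumes "M \<ge> L"
  shows "q ^ L dvd rogers_fine_sum M q (q ^ (2 * k + 1)) (q ^ (2 * k + 1))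
     - (1 + q ^ (2 * k + 1)
     - q ^ (6 * k + 5) * rogers_fine_sum M q (q ^ (2 * k + 3)) (q ^ (2 * k + 3)))"
proof -
  define a where "a = q ^ (2 * k + 1)"
  have eq: "q ^ (2 * k + 3) = a * q\<^sup>2" "q ^ (6 * k + 5) = a ^ 3 * q\<^sup>2"
    unfolding a_def power_add[symmetric] power_mult[symmetric]
    by (rule arg_cong[of _ _ "\<lambda>n. q ^ n"], simp)+
  have pow: "q ^ L dvd a ^ M" "q ^ L dvd a ^ Suc M"
    unfolding a_def power_mult[symmetric] using assms
    by (auto intro!: le_imp_power_dvd simp: trans_le_add1 add_mult_distrib simp del: power_Suc)
  \<comment> \<open>The first error term is the last summand of the sum with \<open>Suc M\<close>
    terms, the second the remainder of the diagonal formula.\<close>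
  have "rogers_fine_sum M q a a - (1 + a - a ^ 3 * q\<^sup>2 * rogers_fine_sum M q (a * q\<^sup>2) (a * q\<^sup>2))
    = - (a ^ M * (\<Prod>i<M. 1 - a * q ^ (2 * i))) - a ^ Suc M * (\<Prod>i<M. 1 - a * q\<^sup>2 * q ^ (2 * i))"
    using rogers_fine_sum_diagonal[of M q a] by (simp add: rogers_fine_sum_def algebra_simps)
  also have "q ^ L dvd \<dots>"
    using pow by (intro dvd_diff dvd_mult2) auto
  finally show ?thesis
    unfolding eq a_def[symmetric] .
qed

text \<open>Iterating \<open>J\<close> times collects the factors \<open>- q ^ (6 * k + 5)\<close>
  for \<open>k < J\<close>, and these exponents add up to
  \<open>3 * J\<^sup>2 + 2 * J\<close>.\<close>

lemma rogers_fine_sum_false_theta: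
  assumes "M \<ge> L"
  shows "q ^ L dvd rogers_fine_sum M q q q
      - (\<Sum>j<J. (-1) ^ j * (q ^ (3 * j\<^sup>2 + 2 * j) + q ^ (3 * j\<^sup>2 + 4 * j + 1)))
     - (-1) ^ J * q ^ (3 * J\<^sup>2 + 2 * J) * rogers_fine_sum M q (q ^ (2 * J + 1)) (q ^ (2 * J + 1))"
proof (induction J)
  case (Suc J)
  let ?G = "\<lambda>k. rogers_fine_sum M q (q ^ (2 * k + 1)) (q ^ (2 * k + 1))"
  let ?e = "(-1) ^ J * q ^ (3 * J\<^sup>2 + 2 * J)"
  have e: "q ^ (3 * (Suc J)\<^sup>2 + 2 * Suc J) = q ^ (3 * J\<^sup>2 + 2 * J) * q ^ (6 * J + 5)"
    "q ^ (3 * J\<^sup>2 + 4 * J + 1) = q ^ (3 * J\<^sup>2 + 2 * J) * q ^ (2 * J + 1)"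
    unfolding power_add[symmetric]
    by (rule arg_cong[of _ _ "\<lambda>n. q ^ n"], simp add: power2_eq_square algebra_simps)+
  have step: "(x - s - e * u * g) + e * u * (g - (1 + v - w * h))
      = x - (s + e * (u + u * v)) - (- 1 * e) * (u * w) * h"
    for x s e u g v w h :: 'a
    by (simp add: algebra_simps)
  have odd: "2 * Suc J + 1 = 2 * J + 3"
    by simp
  have "q ^ L dvd (rogers_fine_sum M q q q
      - (\<Sum>j<J. (-1) ^ j * (q ^ (3 * j\<^sup>2 + 2 * j) + q ^ (3 * j\<^sup>2 + 4 * j + 1))) - ?e * ?G J)
     + ?e * (?G J - (1 + q ^ (2 * J + 1)
     - q ^ (6 * J + 5) * rogers_fine_sum M q (q ^ (2 * J + 3)) (q ^ (2 * J + 3))))"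
    by (intro dvd_add Suc dvd_mult rogers_fine_sum_odd_power assms)
  then show ?case
    unfolding odd sum.lessThan_Suc e power_Suc[of "-1"] step .
qed simp

lemma odd_block_sum_eq_rogers_fine_sum: "odd_block_sum q L 0 1 = rogers_fine_sum (Suc L) q q q"
  by (simp add: odd_block_sum_def rogers_fine_sum_def odd_block_prod_def lessThan_Suc_atMost
      mult.commute)

lemma min_part_sum_false_theta:
  "q ^ L dvd min_part_sum q L 0
      - (\<Sum>j<L. (-1) ^ j * (q ^ (3 * j\<^sup>2 + 2 * j) + q ^ (3 * j\<^sup>2 + 4 * j + 1)))"
proof -
  let ?T = "\<Sum>j<L. (-1) ^ j * (q ^ (3 * j\<^sup>2 + 2 * j) + q ^ (3 * j\<^sup>2 + 4 * j + 1))"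
  let ?E = "(-1) ^ L * q ^ (3 * L\<^sup>2 + 2 * L)
      * rogers_fine_sum (Suc L) q (q ^ (2 * L + 1)) (q ^ (2 * L + 1))"
  \<comment> \<open>After \<open>L\<close> iterations the remainder carries the exponent
    \<open>3 * L\<^sup>2 + 2 * L \<ge> L\<close>.\<close>
  have "q ^ L dvd ?E"
    by (intro dvd_mult2 dvd_mult le_imp_power_dvd) auto
  then have "q ^ L dvd (min_part_sum q L 0 - odd_block_sum q L 0 1)
      + (rogers_fine_sum (Suc L) q q q - ?T - ?E) + ?E"
    by (intro dvd_add min_part_sum_cong_odd_block_sum rogers_fine_sum_false_theta) auto
  then show ?thesis
    unfolding odd_block_sum_eq_rogers_fine_sum by simp
qed

section \<open>Signed counting of partitions by smallest part\<close>

definition tail_parts :: "nat \<Rightarrow> nat \<Rightarrow> nat set" where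
  "tail_parts L m = {m<..2 * m} \<union> (*) 2 ` {m<..L}"

lemma finite_tail_parts: "finite (tail_parts L m)"
  by (simp add: tail_parts_def)

lemma mem_tail_parts_iff:
  assumes "m \<le> L"
  shows "k \<in> tail_parts L m \<longleftrightarrow> m < k \<and> (if odd k then k < 2 * m else k \<le> 2 * L)"
proof (cases "odd k")
  case True
  then have "k \<noteq> 2 * i" for i
    by auto
  moreover have "k \<le> 2 * m \<longleftrightarrow> k < 2 * m"
    using calculation[of m] by linarith
  ultimately have "k \<in> tail_parts L m \<longleftrightarrow> m < k \<and> k < 2 * m"
    unfolding tail_parts_def by (simp add: image_iff)
  then show ?thesis
    using True by simp
next
  case False
  then obtain i where "k = 2 * i"
    by blast
  then show ?thesis
    using assms by (auto simp: tail_parts_def image_iff)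
qed

lemma min_part_prod_eq_prod_tail_parts: "min_part_prod q L m = (\<Prod>k\<in>tail_parts L m. 1 - q ^ k)"
proof -
  have "(\<Prod>i<m. 1 - q ^ (m + 1 + i)) = (\<Prod>k\<in>{m<..2 * m}. 1 - q ^ k)"
    by (rule prod.reindex_bij_witness[of _ "\<lambda>k. k - Suc m" "\<lambda>i. m + 1 + i"]) auto
  moreover have "(\<Prod>i\<in>{m<..L}. 1 - q ^ (2 * i)) = (\<Prod>k\<in>(*) 2 ` {m<..L}. 1 - q ^ k)"
    by (simp add: prod.reindex inj_on_def)
  ultimately show ?thesis
    unfolding min_part_prod_def tail_parts_def by (subst prod.union_disjoint) auto
qed

lemma prod_one_minus_power_eq_sum:
  fixes q :: "'a::comm_ring_1"
  assumes "finite A"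
  shows "(\<Prod>k\<in>A. 1 - q ^ k) = (\<Sum>T\<in>Pow A. (- 1) ^ card T * q ^ \<Sum>T)"
  using assms by (simp add: prod_diff_conv_sum power_sum[of q "\<lambda>k. k"])

text \<open>A partition \<open>P\<close> corresponds to the pair
  \<open>(Min P, P - {Min P})\<close>; removing the smallest part flips the sign. As parts are at
  most \<open>n \<le> L\<close>, the truncation loses no partition.\<close>

lemma coeff_min_part_sum_monom:
  assumes "n \<le> L"
  shows "coeff (min_part_sum (monom 1 1 :: int poly) L 0) n
      = (\<Sum>P\<in>odd_bounded_partitions n. - ((- 1) ^ card P))"
proof -
  let ?I = "SIGMA m:{..L}. Pow (tail_parts L m)"
  have "min_part_sum (monom 1 1 :: int poly) L 0
      = (\<Sum>m\<le>L. \<Sum>T\<in>Pow (tail_parts L m). monom ((- 1) ^ card T) (m + \<Sum>T))"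
    unfolding min_part_sum_def min_part_prod_eq_prod_tail_parts
      prod_one_minus_power_eq_sum[OF finite_tail_parts] sum_distrib_left
  proof (intro sum.cong refl)
    fix m and T :: "nat set"
    have "(- 1 :: int poly) ^ card T = monom ((- 1) ^ card T) 0"
      by (simp add: monom_0 one_pCons poly_const_pow)
    then show "monom 1 1 ^ ((0 + 1) * m) * ((- 1) ^ card T * monom 1 1 ^ \<Sum>T)
        = (monom ((- 1) ^ card T) (m + \<Sum>T) :: int poly)"
      by (simp add: monom_power mult_monom add.commute)
  qed
  then have "coeff (min_part_sum (monom 1 1 :: int poly) L 0) n
      = (\<Sum>(m, T)\<in>?I. if m + \<Sum>T = n then (- 1) ^ card T else 0)"
    by (simp add: coeff_sum sum.Sigma finite_tail_parts split_def)
  also have "\<dots> = (\<Sum>(m, T)\<in>{(m, T) \<in> ?I. m + \<Sum>T = n}. (- 1) ^ card T)"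
    by (rule sum.mono_neutral_cong_right) (auto simp: finite_tail_parts split: if_splits)
  also have "\<dots> = (\<Sum>P\<in>odd_bounded_partitions n. - ((- 1) ^ card P))"
  proof (rule sum.reindex_bij_witness[of _ "\<lambda>P. (Min P, P - {Min P})" "\<lambda>(m, T). insert m T"])
    fix x assume "x \<in> {(m, T) \<in> ?I. m + \<Sum>T = n}"
    then obtain m T where x: "x = (m, T)" and m: "m \<le> L" and T: "T \<subseteq> tail_parts L m"
      and sum: "m + \<Sum>T = n"
      by auto
    have fin: "finite T"
      using T finite_tail_parts finite_subset by blast
    have T': "m < k" "odd k \<Longrightarrow> k < 2 * m" if "k \<in> T" for k
      using T that mem_tail_parts_iff[OF m, of k] by auto
    then have m_notin: "m \<notin> T"
      by blast
    have Min: "Min (insert m T) = m"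
      using fin T' by (intro Min_eqI) (auto simp: less_imp_le)
    show "(Min (case x of (m, T) \<Rightarrow> insert m T),
        (case x of (m, T) \<Rightarrow> insert m T) - {Min (case x of (m, T) \<Rightarrow> insert m T)}) = x"
      using x Min m_notin by simp
    \<comment> \<open>The smallest part must obey the bound as well; oddness rules out
      \<open>m = 0\<close>.\<close>
    have "odd m \<Longrightarrow> m < 2 * m"
      by (cases m) auto
    then show "(case x of (m, T) \<Rightarrow> insert m T) \<in> odd_bounded_partitions n"
      using x Min fin m_notin sum T'
      by (auto simp: odd_bounded_partitions_def distinct_partitions_def)
    show "- ((- 1 :: int) ^ card (case x of (m, T) \<Rightarrow> insert m T)) = (case x of (m, T) \<Rightarrow> (- 1) ^ card T)"
      using x fin m_notin by simp
  next
    fix P assume P: "P \<in> odd_bounded_partitions n"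
    then have fin: "finite P" and ne: "P \<noteq> {}" and sum: "\<Sum>P = n"
      and odd: "\<And>k. k \<in> P \<Longrightarrow> odd k \<Longrightarrow> k < 2 * Min P"
      by (auto simp: odd_bounded_partitions_def distinct_partitions_def)
    have Min: "Min P \<in> P"
      using fin ne by simp
    then show "(case (Min P, P - {Min P}) of (m, T) \<Rightarrow> insert m T) = P"
      by auto
    have le: "k \<le> n" if "k \<in> P" for k
      using member_le_sum[of k P "\<lambda>k. k"] that fin sum by simp
    have "Min P \<le> L"
      using le[OF Min] assms by simp
    moreover have "k \<in> tail_parts L (Min P)" if "k \<in> P - {Min P}" for k
    proof -
      have "Min P < k"
        using that Min_le[OF fin, of k] by (simp add: order_less_le)
      then show ?thesis
        using that odd le[of k] assms by (auto simp: mem_tail_parts_iff[OF \<open>Min P \<le> L\<close>])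
    qed
    moreover have "Min P + \<Sum>(P - {Min P}) = n"
      using sum.remove[OF fin Min, of "\<lambda>k. k"] sum by simp
    ultimately show "(Min P, P - {Min P}) \<in> {(m, T) \<in> ?I. m + \<Sum>T = n}"
      by auto
  qed
  finally show ?thesis .
qed

lemma d_o_minus_d_e:
  "int (d_o n) - int (d_e n) = (\<Sum>P\<in>odd_bounded_partitions n. - ((- 1) ^ card P))"
proof -
  let ?A = "odd_bounded_partitions n"
  have "(\<Sum>P\<in>?A. - ((- 1) ^ card P) :: int)
      = (\<Sum>P\<in>?A. of_bool (odd (card P)) - of_bool (even (card P)))"
    by (intro sum.cong) auto
  also have "\<dots> = int (d_o n) - int (d_e n)"
    by (simp add: sum_subtractf d_o_def d_e_def finite_odd_bounded_partitions Int_def)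
  finally show ?thesis ..
qed

section \<open>Comparison of coefficients\<close>

lemma difference_eq_false_theta_coeff:
  "int (d_o n) - int (d_e n)
     = (\<Sum>j\<le>n. (- 1) ^ j * (of_bool (3 * j\<^sup>2 + 2 * j = n) + of_bool (3 * j\<^sup>2 + 4 * j + 1 = n)))"
proof -
  let ?X = "monom 1 1 :: int poly"
  let ?T = "\<Sum>j<Suc n. (- 1) ^ j * (?X ^ (3 * j\<^sup>2 + 2 * j) + ?X ^ (3 * j\<^sup>2 + 4 * j + 1))"
  \<comment> \<open>The truncation is at \<open>Suc n\<close> because a congruence modulo
    \<open>?X ^ Suc n\<close> fixes the coefficient at \<open>n\<close>.\<close>
  have "monom 1 (Suc n) dvd min_part_sum ?X (Suc n) 0 - ?T"
    using min_part_sum_false_theta[of ?X "Suc n"] unfolding monom_power[of _ _ "Suc n"]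
    by (simp only: mult_1 power_one)
  then have "coeff (min_part_sum ?X (Suc n) 0) n = coeff ?T n"
    by (simp add: monom_1_dvd_iff')
  moreover have "coeff ((- 1) ^ j * p) n = (- 1) ^ j * coeff p n" for j and p :: "int poly"
    by (cases "even j") auto
  ultimately have "coeff (min_part_sum ?X (Suc n) 0) n
      = (\<Sum>j\<le>n. (- 1) ^ j * (of_bool (3 * j\<^sup>2 + 2 * j = n) + of_bool (3 * j\<^sup>2 + 4 * j + 1 = n)))"
    by (simp add: coeff_sum monom_power lessThan_Suc_atMost of_bool_def del: power_Suc One_nat_def)
  then show ?thesis
    unfolding d_o_minus_d_e using coeff_min_part_sum_monom[of n "Suc n"] by (simp del: One_nat_def)
qed

text \<open>The larger exponent for \<open>i\<close> is below the smaller one for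
  \<open>i + 1\<close>, which is \<open>3 * i\<^sup>2 + 8 * i + 5\<close>.\<close>

lemma false_theta_exponents_distinct:
  fixes i j n :: nat
  assumes "n = 3 * i\<^sup>2 + 2 * i \<or> n = 3 * i\<^sup>2 + 4 * i + 1"
    and "n = 3 * j\<^sup>2 + 2 * j \<or> n = 3 * j\<^sup>2 + 4 * j + 1"
  shows "i = j"
proof -
  have *: "3 * i\<^sup>2 + 4 * i + 1 < 3 * j\<^sup>2 + 2 * j" if "i < j" for i j :: nat
  proof -
    have "(Suc i)\<^sup>2 \<le> j\<^sup>2"
      using that by (intro power_mono) auto
    then show ?thesis
      using that by (simp add: power2_eq_square)
  qed
  show ?thesis
    using assms *[of i j] *[of j i] by (cases i j rule: linorder_cases) auto
qed

theorem theorem5p4: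
  fixes n :: nat
  shows "(\<forall>j::nat. n = 3 * j^2 + 2 * j \<or> n = 3 * j^2 + 4 * j + 1
            \<longrightarrow> int (d_o n) - int (d_e n) = (-1) ^ j) \<and>
         ((\<nexists>j::nat. n = 3 * j^2 + 2 * j \<or> n = 3 * j^2 + 4 * j + 1)
            \<longrightarrow> int (d_o n) - int (d_e n) = 0)"
proof (intro conjI allI impI)
  let ?t = "\<lambda>j. (- 1 :: int) ^ j * (of_bool (3 * j\<^sup>2 + 2 * j = n)
      + of_bool (3 * j\<^sup>2 + 4 * j + 1 = n))"
  fix j assume j: "n = 3 * j^2 + 2 * j \<or> n = 3 * j^2 + 4 * j + 1"
  have "j \<le> n"
    using j by auto
  moreover have "?t i = (if i = j then (- 1) ^ j else 0)" for i
  proof (cases "i = j")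
    case True
    \<comment> \<open>Exactly one indicator is 1, since the two exponents differ by
      \<open>2 * j + 1\<close>.\<close>
    then show ?thesis
      using j by (auto simp: of_bool_def)
  next
    case False
    then show ?thesis
      using false_theta_exponents_distinct[OF _ j, of i] by (simp add: of_bool_def) metis
  qed
  ultimately show "int (d_o n) - int (d_e n) = (- 1) ^ j"
    unfolding difference_eq_false_theta_coeff by simp
next
  assume "\<nexists>j. n = 3 * j^2 + 2 * j \<or> n = 3 * j^2 + 4 * j + 1"
  then show "int (d_o n) - int (d_e n) = 0"
    unfolding difference_eq_false_theta_coeff by (intro sum.neutral) auto
qed

end
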